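(* Let $X_c=\{x_0,x_1,\dots,x_{m_c}\}$ and $X_d=\{\tilde x_0,\tilde x_1,\dots,\tilde x_{m_d}\}$. For any $c\in\mathbb{R}^{m_d}\langle\langle X_c\rangle\rangle$ and $d\in\mathbb{R}^{m_c}\langle\langle X_d\rangle\rangle$, the feedback product satisfies $$c@d=c\,\tilde\circ\,(-d\circ c)^{-1}=c\circ(\delta-d\circ c)^{-1}.$$
   Context: For an alphabet $X$ of noncommuting letters, $X^*$ is the monoid of words including the empty word $\emptyset$, and $\mathbb{R}^\ell\langle\langle X\rangle\rangle$ is the set of formal power series $c:X^*\to\mathbb{R}^\ell$, $c=\sum_\eta(c,\eta)\eta$, with component series $c_i$. The shuffle product $\sqcup\!\sqcup$ is the bilinear product with $(x_i\eta)\sqcup\!\sqcup(x_j\xi)=x_i(\eta\sqcup\!\sqcup(x_j\xi))+x_j((x_i\eta)\sqcup\!\sqcup\xi)$ and $\eta\sqcup\!\sqcup\emptyset=\emptyset\sqcup\!\sqcup\eta=\eta$. Composition product: for $d\in\mathbb{R}^{\ell}\langle\langle X_d\rangle\rangle$ and $c\in\mathbb{R}^{m_d}\langle\langle X_c\rangle\rangle$, $d\circ c=\sum_{\eta\in X_d^*}(d,\eta)\,\psi_c(\eta)(1)\in\mathbb{R}^\ell\langle\langle X_c\rangle\rangle$, where $\psi_c$ is the continuous (in the ultrametric sense) algebra homomorphism from $\mathbb{R}\langle\langle X_d\rangle\rangle$ to $\mathrm{End}(\mathbb{R}\langle\langle X_c\rangle\rangle)$ with $\psi_c(\tilde x_i\eta)=\psi_c(\tilde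 x_i)\circ\psi_c(\eta)$, $\psi_c(\tilde x_i)(e)=x_0(c_i\sqcup\!\sqcup e)$ for $i=0,\dots,m_d$ with $c_0:=1$, and $\psi_c(\emptyset)=\mathrm{id}$. Modified composition product: for $c\in\mathbb{R}^\ell\langle\langle X_c\rangle\rangle$ and $e\in\mathbb{R}^{m_c}\langle\langle X_c\rangle\rangle$, $c\,\tilde\circ\,e=\sum_{\eta\in X_c^*}(c,\eta)\,\phi_e(\eta)(1)$, where $\phi_e$ is the continuous algebra homomorphism from $\mathbb{R}\langle\langle X_c\rangle\rangle$ to $\mathrm{End}(\mathbb{R}\langle\langle X_c\rangle\rangle)$ with $\phi_e(x_i\eta)=\phi_e(x_i)\circ\phi_e(\eta)$, $\phi_e(x_i)(f)=x_if+x_0(e_i\sqcup\!\sqcup f)$ for $i=0,\dots,m_c$ with $e_0:=0$, and $\phi_e(\emptyset)=\mathrm{id}$. With $\delta$ a symbol representing (the generating series of) the identity operator, one writes $c\circ(\delta+e):=c\,\tilde\circ\,e$. Inverse: the set of formal elements $\delta+e$, $e\in\mathbb{R}^{m_c}\langle\langle X_c\rangle\rangle$, with product $(\delta+e)\circ(\delta+f)=\delta+f+e\,\tilde\circ\,f$, is a group with identity $\delta$; $e^{-1}$ denotes the series with $(\delta+e)^{-1}=\delta+e^{-1}$. In particular $(\delta-d\circ c)^{-1}=\delta+(-d\circ c)^{-1}$. Feedback product: $c@d\in\mathbb{R}^{m_d}\langle\langle X_c\rangle\rangle$ is the generating series of the closed-loop system $y=F_c[v]$, $v=u+F_d[y]$,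 i.e. $y=F_{c@d}[u]$, where $F_c$ denotes the Fliess operator (Chen–Fliess series) with generating series $c$. As a formal series it is the unique fixed point $e=c@d$ of the map $e\mapsto c\circ(\delta+d\circ e)=c\,\tilde\circ\,(d\circ e)$ (which is a contraction in the ultrametric sense). *)

theory Defs
  imports "HOL-Library.Function_Algebras" "HOL-Library.Groups_Big_Fun"
    "HOL-Analysis.Finite_Cartesian_Product" "HOL-Algebra.Group"
begin

text \<open>
  The alphabet \<open>{x\<^sub>0, x\<^sub>1, \<dots>, x\<^sub>m}\<close> is the type \<open>'m option\<close> with \<open>m = CARD('m)\<close>:
  \<open>None\<close> is \<open>x\<^sub>0\<close> and \<open>Some i\<close>, for \<open>i :: 'm\<close>, ranges over \<open>x\<^sub>1, \<dots>, x\<^sub>m\<close>.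
  Sums, differences and negatives of series are the pointwise ones of
  \<open>Function_Algebras\<close>, whose pointwise product and unit are never used:
  the unit series is \<open>one_series\<close>.
\<close>

type_synonym 'm word = "'m option list"
type_synonym 'm scalar_series = "'m word \<Rightarrow> real"
type_synonym ('m, 'l) series = "'m word \<Rightarrow> real ^ 'l"

definition one_series :: "'m scalar_series" where
  "one_series w = (if w = [] then 1 else 0)"

definition prepend :: "'m option \<Rightarrow> 'm scalar_series \<Rightarrow> 'm scalar_series" where
  "prepend x f w = (case w of [] \<Rightarrow> 0 | y # v \<Rightarrow> if y = x then f v else 0)"

text \<open>\<open>shuffle_words u v w\<close> is the coefficient of \<open>w\<close> in the shuffle product of \<open>u\<close> and \<open>v\<close>.\<close>

fun shuffle_words :: "'m word \<Rightarrow> 'm word \<Rightarrow> 'm scalar_series" where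
  "shuffle_words [] v = (\<lambda>w. if w = v then 1 else 0)"
| "shuffle_words u [] = (\<lambda>w. if w = u then 1 else 0)"
| "shuffle_words (x # u) (y # v) =
     prepend x (shuffle_words u (y # v)) + prepend y (shuffle_words (x # u) v)"

text \<open>
  \<open>Sum_any\<close> is the sum over the support of the summand, and it is 0 if that support is infinite.
  The three families summed below have finite support at every word \<open>w\<close>; see
  \<open>finite_support_shuffle\<close>, \<open>finite_support_composition\<close> and
  \<open>finite_support_mod_composition\<close>.
\<close>

definition shuffle :: "'m scalar_series \<Rightarrow> 'm scalar_series \<Rightarrow> 'm scalar_series"
    (infixr "\<squnion>\<squnion>" 70) where
  "(f \<squnion>\<squnion> g) w = (\<Sum>(u, v). f u * g v * shuffle_words u v w)"

definition component :: "('m, 'l::finite) series \<Rightarrow> 'l \<Rightarrow> 'm scalar_series" where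
  "component c i = (\<lambda>w. c w $ i)"


text \<open>The composition product. The first equation of \<open>psi_letter\<close> is the convention \<open>c\<^sub>0 = 1\<close>.\<close>

primrec psi_letter ::
  "('m, 'k::finite) series \<Rightarrow> 'k option \<Rightarrow> 'm scalar_series \<Rightarrow> 'm scalar_series" where
  "psi_letter c None = (\<lambda>f. prepend None (one_series \<squnion>\<squnion> f))"
| "psi_letter c (Some i) = (\<lambda>f. prepend None (component c i \<squnion>\<squnion> f))"

primrec psi ::
  "('m, 'k::finite) series \<Rightarrow> 'k word \<Rightarrow> 'm scalar_series \<Rightarrow> 'm scalar_series" where
  "psi c [] = id"
| "psi c (x # \<eta>) = psi_letter c x \<circ> psi c \<eta>"

definition composition ::
  "('k::finite, 'l::finite) series \<Rightarrow> ('m, 'k) series \<Rightarrow> ('m, 'l) series"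
    (infixl "\<odot>" 70) where
  "(d \<odot> c) w = (\<Sum>\<eta>. psi c \<eta> one_series w *\<^sub>R d \<eta>)"


text \<open>
  The modified composition product. The first equation of \<open>phi_letter\<close> is the
  convention \<open>e\<^sub>0 = 0\<close>.
\<close>

primrec phi_letter ::
  "('m::finite, 'm) series \<Rightarrow> 'm option \<Rightarrow> 'm scalar_series \<Rightarrow> 'm scalar_series" where
  "phi_letter e None = (\<lambda>f. prepend None f + prepend None (0 \<squnion>\<squnion> f))"
| "phi_letter e (Some i) =
     (\<lambda>f. prepend (Some i) f + prepend None (component e i \<squnion>\<squnion> f))"

primrec phi ::
  "('m::finite, 'm) series \<Rightarrow> 'm word \<Rightarrow> 'm scalar_series \<Rightarrow> 'm scalar_series" where
  "phi e [] = id"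
| "phi e (x # \<eta>) = phi_letter e x \<circ> phi e \<eta>"

definition mod_composition ::
  "('m::finite, 'l::finite) series \<Rightarrow> ('m, 'm) series \<Rightarrow> ('m, 'l) series"
    (infixl "\<odot>\<^sub>m" 70) where
  "(c \<odot>\<^sub>m e) w = (\<Sum>\<eta>. phi e \<eta> one_series w *\<^sub>R c \<eta>)"


text \<open>\<open>Delta e\<close> is the formal element \<open>\<delta> + e\<close>.\<close>

datatype (dead 'm::finite) delta_series = Delta (delta_part: "('m, 'm) series")

primrec delta_composition ::
  "('m::finite, 'l::finite) series \<Rightarrow> 'm delta_series \<Rightarrow> ('m, 'l) series"
    (infixl "\<odot>\<^sub>\<delta>" 70) where
  "c \<odot>\<^sub>\<delta> Delta e = c \<odot>\<^sub>m e"

definition delta_group :: "'m::finite delta_series monoid" where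
  "delta_group =
    \<lparr>carrier = UNIV,
     mult = (\<lambda>a b. Delta (delta_part b + delta_part a \<odot>\<^sub>m delta_part b)),
     one = Delta 0\<rparr>"

definition series_inverse :: "('m::finite, 'm) series \<Rightarrow> ('m, 'm) series" where
  "series_inverse e = delta_part (inv\<^bsub>delta_group\<^esub> (Delta e))"

definition feedback ::
  "('m::finite, 'k::finite) series \<Rightarrow> ('k, 'm) series \<Rightarrow> ('m, 'k) series" where
  "feedback c d = (THE e. e = c \<odot>\<^sub>m (d \<odot> e))"


subsection \<open>Local finiteness of the defining sums\<close>

lemma prepend_nonzeroE:
  assumes "prepend x f w \<noteq> 0"
  obtains v where "w = x # v" "f v \<noteq> 0"
  using assms by (auto simp: prepend_def split: list.splits if_splits)

lemma length_shuffle_words: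
  "shuffle_words u v w \<noteq> 0 \<Longrightarrow> length w = length u + length v"
proof (induction u v arbitrary: w rule: shuffle_words.induct)
  case (3 x u y v)
  then have "prepend x (shuffle_words u (y # v)) w \<noteq> 0 \<or>
      prepend y (shuffle_words (x # u) v) w \<noteq> 0"
    by auto
  then show ?case
    using "3.IH" by (fastforce elim!: prepend_nonzeroE)
qed (auto split: if_splits)

lemma length_shuffle_words_le:
  assumes "shuffle_words u v w \<noteq> 0"
  shows "length u \<le> length w" "length v \<le> length w"
  using length_shuffle_words[OF assms] by simp_all

lemma finite_words_length_le: "finite {u :: 'm::finite word. length u \<le> n}"
  using finite_lists_length_le[of "UNIV :: 'm option set" n] by simp

lemma finite_support_shuffle:
  fixes f g :: "'m::finite scalar_series"
  shows "finite {p. (\<lambda>(u, v). f u * g v * shuffle_words u v w) p \<noteq> 0}"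
proof (rule finite_subset)
  show "{p. (\<lambda>(u, v). f u * g v * shuffle_words u v w) p \<noteq> 0} \<subseteq>
      {u. length u \<le> length w} \<times> {v. length v \<le> length w}"
    by (auto intro: length_shuffle_words_le)
  show "finite ({u :: 'm word. length u \<le> length w} \<times> {v :: 'm word. length v \<le> length w})"
    by (intro finite_cartesian_product finite_words_length_le)
qed

lemma shuffle_nonzeroE:
  fixes f g :: "'m::finite scalar_series"
  assumes "(f \<squnion>\<squnion> g) w \<noteq> 0"
  obtains v where "g v \<noteq> 0" "length v \<le> length w"
proof -
  from assms obtain p where "(\<lambda>(u, v). f u * g v * shuffle_words u v w) p \<noteq> 0"
    unfolding shuffle_def by (rule Sum_any.not_neutral_obtains_not_neutral)
  then show ?thesis
    using that by (auto intro: length_shuffle_words_le split: prod.splits)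
qed

lemma length_psi:
  fixes c :: "('m::finite, 'k::finite) series"
  shows "psi c \<eta> f w \<noteq> 0 \<Longrightarrow> length \<eta> \<le> length w"
proof (induction \<eta> arbitrary: w)
  case (Cons x \<eta>)
  then show ?case
    by (cases x) (fastforce elim!: prepend_nonzeroE shuffle_nonzeroE)+
qed simp

lemma length_phi: "phi e \<eta> f w \<noteq> 0 \<Longrightarrow> length \<eta> \<le> length w"
proof (induction \<eta> arbitrary: w)
  case (Cons x \<eta>)
  obtain g where "phi_letter e x (phi e \<eta> f) =
      prepend x (phi e \<eta> f) + prepend None (g \<squnion>\<squnion> phi e \<eta> f)"
    by (cases x) auto
  with Cons.prems have "prepend x (phi e \<eta> f) w \<noteq> 0 \<or>
      prepend None (g \<squnion>\<squnion> phi e \<eta> f) w \<noteq> 0"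
    by auto
  then show ?case
    using Cons.IH by (fastforce elim!: prepend_nonzeroE shuffle_nonzeroE)
qed simp

lemma finite_support_composition:
  fixes c :: "('m::finite, 'k::finite) series" and d :: "('k, 'l::finite) series"
  shows "finite {\<eta>. psi c \<eta> one_series w *\<^sub>R d \<eta> \<noteq> 0}"
  by (rule finite_subset[OF _ finite_words_length_le[of "length w"]])
     (auto intro: length_psi)

lemma finite_support_mod_composition:
  fixes c :: "('m::finite, 'l::finite) series"
  shows "finite {\<eta>. phi e \<eta> one_series w *\<^sub>R c \<eta> \<noteq> 0}"
  by (rule finite_subset[OF _ finite_words_length_le[of "length w"]])
     (auto intro: length_phi)

end

theory Submission
  imports Defs
begin

text \<open>
  Substituting \<open>\<delta> + e\<close> for the letters is a shuffle homomorphism, because the left quotients are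
  shuffle derivations and substitution commutes with them up to shuffle multiplication by components
  of \<open>e\<close>. This makes the modified composition associative, both with itself and with the
  composition product. Hence \<open>e\<close> is a fixed point of \<open>e \<mapsto> c \<odot>\<^sub>m (d \<odot> e)\<close> iff \<open>e = c \<odot>\<^sub>m x\<close> for some
  \<open>x = d \<odot> (c \<odot>\<^sub>m x) = d \<odot> c \<odot>\<^sub>m x\<close>, and this last equation says that \<open>\<delta> + x\<close> is a right inverse of
  \<open>\<delta> - d \<odot> c\<close>. Only the existence of inverses uses the contraction property; uniqueness of the fixed
  point is uniqueness of inverses in a group.
\<close>

section \<open>Sums over words of bounded length\<close>

definition words_upto :: "nat \<Rightarrow> 'm::finite word set" where
  "words_upto n = {u. length u \<le> n}"

lemma mem_words_upto [simp]: "u \<in> words_upto n \<longleftrightarrow> length u \<le> n"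
  by (simp add: words_upto_def)

lemma finite_words_upto [simp, intro]: "finite (words_upto n)"
  unfolding words_upto_def by (rule finite_words_length_le)

lemma words_upto_0 [simp]: "words_upto 0 = {[]}"
  by (auto simp: words_upto_def)

lemma sum_words_upto_Suc:
  fixes F :: "'m::finite word \<Rightarrow> 'a::comm_monoid_add"
  shows "(\<Sum>u\<in>words_upto (Suc n). F u) = F [] + (\<Sum>x\<in>UNIV. \<Sum>u\<in>words_upto n. F (x # u))"
proof -
  have split: "words_upto (Suc n) = insert [] (\<Union>x::'m option. (#) x ` words_upto n)"
  proof (rule Set.set_eqI)
    show "u \<in> words_upto (Suc n) \<longleftrightarrow>
        u \<in> insert [] (\<Union>x::'m option. (#) x ` words_upto n)" for u
      by (cases u) (auto simp: image_iff)
  qed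
  have "(\<Sum>u\<in>words_upto (Suc n). F u) = F [] + (\<Sum>u\<in>(\<Union>x::'m option. (#) x ` words_upto n). F u)"
    unfolding split by (rule sum.insert) auto
  also have "(\<Sum>u\<in>(\<Union>x::'m option. (#) x ` words_upto n). F u)
      = (\<Sum>x\<in>UNIV. \<Sum>u\<in>(#) x ` words_upto n. F u)"
    by (rule sum.UNION_disjoint) auto
  also have "\<dots> = (\<Sum>x\<in>UNIV. \<Sum>u\<in>words_upto n. F (x # u))"
    by (simp add: sum.reindex)
  finally show ?thesis .
qed

text \<open>Only words starting with \<open>x\<close> survive, and stripping that letter lowers the
  length bound by one. The \<open>case\<close> has the shape produced by
  \<open>shuffle_words_Cons\<close>.\<close>

lemma sum_words_upto_Suc_letter:
  fixes F :: "'m::finite word \<Rightarrow> 'a::semiring_0"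
  shows "(\<Sum>u\<in>words_upto (Suc n). F u *
      (case u of [] \<Rightarrow> 0 | y # u' \<Rightarrow> if y = x then G u' else 0))
    = (\<Sum>u\<in>words_upto n. F (x # u) * G u)"
proof -
  have "(\<Sum>y\<in>UNIV. \<Sum>u\<in>words_upto n. F (y # u) * (if y = x then G u else 0))
      = (\<Sum>y\<in>UNIV. if y = x then \<Sum>u\<in>words_upto n. F (x # u) * G u else 0)"
    by (intro sum.cong) auto
  then show ?thesis by (simp add: sum_words_upto_Suc)
qed

lemma Sum_any_eq_sum_words_upto:
  fixes F :: "'m::finite word \<Rightarrow> 'a::comm_monoid_add"
  assumes "\<And>u. F u \<noteq> 0 \<Longrightarrow> length u \<le> n"
  shows "Sum_any F = (\<Sum>u\<in>words_upto n. F u)"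
  by (rule Sum_any.expand_superset) (use assms in auto)


section \<open>The shuffle algebra\<close>

definition left_quotient :: "'m option \<Rightarrow> 'm scalar_series \<Rightarrow> 'm scalar_series" where
  "left_quotient x f = (\<lambda>w. f (x # w))"

lemma left_quotient_apply [simp]: "left_quotient x f w = f (x # w)"
  by (simp add: left_quotient_def)

lemma prepend_simps [simp]:
  "prepend x f [] = 0"
  "prepend x f (y # w) = (if y = x then f w else 0)"
  by (simp_all add: prepend_def)

lemma one_series_simps [simp]: "one_series [] = 1" "one_series (x # w) = 0"
  by (simp_all add: one_series_def)

text \<open>Shuffling adds lengths, so longer words contribute nothing at \<open>w\<close>. The
  bounds are independent because \<open>shuffle_Cons\<close> shortens only one factor at a
  time.\<close>

lemma shuffle_eq_sum:
  fixes f g :: "'m::finite scalar_series"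
  assumes "length w \<le> n" "length w \<le> m"
  shows "(f \<squnion>\<squnion> g) w = (\<Sum>u\<in>words_upto n. \<Sum>v\<in>words_upto m. f u * g v * shuffle_words u v w)"
proof -
  have "(f \<squnion>\<squnion> g) w = (\<Sum>(u, v)\<in>words_upto n \<times> words_upto m. f u * g v * shuffle_words u v w)"
    unfolding shuffle_def
  proof (rule Sum_any.expand_superset)
    show "{p. (case p of (u, v) \<Rightarrow> f u * g v * shuffle_words u v w) \<noteq> 0}
        \<subseteq> words_upto n \<times> words_upto m"
      using assms by (auto dest!: length_shuffle_words)
  qed auto
  then show ?thesis by (simp add: sum.cartesian_product)
qed

lemma shuffle_words_Nil_right: "shuffle_words u [] = (\<lambda>w. if w = u then 1 else 0)"
  by (cases u) auto

text \<open>The first letter of a shuffle is the first letter of one of the two words. This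
  recursion on the target word is what the derivation law needs.\<close>

lemma shuffle_words_Cons:
  "shuffle_words u v (z # w) =
    (case u of [] \<Rightarrow> 0 | x # u' \<Rightarrow> if x = z then shuffle_words u' v w else 0) +
    (case v of [] \<Rightarrow> 0 | y # v' \<Rightarrow> if y = z then shuffle_words u v' w else 0)"
  by (cases "(u, v)" rule: shuffle_words.cases)
     (auto simp: shuffle_words_Nil_right split: list.splits)

lemma shuffle_Nil [simp]:
  fixes f g :: "'m::finite scalar_series"
  shows "(f \<squnion>\<squnion> g) [] = f [] * g []"
  by (subst shuffle_eq_sum[of _ 0 0]) simp_all

text \<open>Left quotients are derivations of the shuffle product. Together with \<open>shuffle_Nil\<close> this
  determines the product, so that its algebraic laws follow by induction on the word.\<close>

lemma shuffle_Cons [simp]: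
  fixes f g :: "'m::finite scalar_series"
  shows "(f \<squnion>\<squnion> g) (x # w) = (left_quotient x f \<squnion>\<squnion> g) w + (f \<squnion>\<squnion> left_quotient x g) w"
proof -
  let ?n = "length w"
  let ?L = "\<lambda>u v. case u of [] \<Rightarrow> 0 | y # u' \<Rightarrow> if y = x then shuffle_words u' v w else 0"
  let ?R = "\<lambda>u v. case v of [] \<Rightarrow> 0 | y # v' \<Rightarrow> if y = x then shuffle_words u v' w else 0"
  let ?W = "words_upto (Suc ?n)"
  have "(f \<squnion>\<squnion> g) (x # w) = (\<Sum>u\<in>?W. \<Sum>v\<in>?W. f u * g v * (?L u v + ?R u v))"
    by (subst shuffle_eq_sum[of _ "Suc ?n" "Suc ?n"]) (simp_all only: shuffle_words_Cons length_Cons)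
  also have "\<dots> = (\<Sum>u\<in>?W. \<Sum>v\<in>?W. f u * g v * ?L u v) + (\<Sum>u\<in>?W. \<Sum>v\<in>?W. f u * g v * ?R u v)"
    by (simp only: distrib_left sum.distrib)
  also have "(\<Sum>u\<in>?W. \<Sum>v\<in>?W. f u * g v * ?L u v)
      = (\<Sum>u\<in>words_upto ?n. \<Sum>v\<in>?W. f (x # u) * g v * shuffle_words u v w)"
    by (subst (1 2) sum.swap) (simp only: sum_words_upto_Suc_letter)
  also have "\<dots> = (left_quotient x f \<squnion>\<squnion> g) w"
    by (subst shuffle_eq_sum[of _ ?n "Suc ?n"]) simp_all
  also have "(\<Sum>u\<in>?W. \<Sum>v\<in>?W. f u * g v * ?R u v)
      = (\<Sum>u\<in>?W. \<Sum>v\<in>words_upto ?n. f u * g (x # v) * shuffle_words u v w)"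
    by (simp only: sum_words_upto_Suc_letter)
  also have "\<dots> = (f \<squnion>\<squnion> left_quotient x g) w"
    by (subst shuffle_eq_sum[of _ "Suc ?n" ?n]) simp_all
  finally show ?thesis .
qed

lemma left_quotient_plus [simp]: "left_quotient x (f + g) = left_quotient x f + left_quotient x g"
  by (simp add: fun_eq_iff)

lemma left_quotient_zero [simp]: "left_quotient x 0 = 0"
  by (simp add: fun_eq_iff)

lemma left_quotient_one_series [simp]: "left_quotient x one_series = 0"
  by (simp add: fun_eq_iff)

lemma left_quotient_prepend [simp]: "left_quotient x (prepend y f) = (if x = y then f else 0)"
  by (simp add: fun_eq_iff)

lemma prepend_plus: "prepend x (f + g) = prepend x f + prepend x g"
proof
  show "prepend x (f + g) w = (prepend x f + prepend x g) w" for w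
    by (cases w) simp_all
qed

lemma prepend_zero [simp]: "prepend x 0 = 0"
  using prepend_plus[of x 0 0] by simp

lemma left_quotient_shuffle [simp]:
  fixes f g :: "'m::finite scalar_series"
  shows "left_quotient x (f \<squnion>\<squnion> g) = left_quotient x f \<squnion>\<squnion> g + f \<squnion>\<squnion> left_quotient x g"
  by (simp add: fun_eq_iff)

lemma shuffle_commute:
  fixes f g :: "'m::finite scalar_series"
  shows "f \<squnion>\<squnion> g = g \<squnion>\<squnion> f"
proof
  show "(f \<squnion>\<squnion> g) w = (g \<squnion>\<squnion> f) w" for w
    by (induction w arbitrary: f g) (simp_all add: ac_simps)
qed

lemma shuffle_zero_left [simp]:
  fixes f :: "'m::finite scalar_series"
  shows "0 \<squnion>\<squnion> f = 0"
proof
  show "(0 \<squnion>\<squnion> f) w = 0 w" for w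
    by (induction w arbitrary: f) simp_all
qed

lemma shuffle_zero_right [simp]:
  fixes f :: "'m::finite scalar_series"
  shows "f \<squnion>\<squnion> 0 = 0"
  by (simp add: shuffle_commute[of f])

lemma shuffle_plus_left:
  fixes f g h :: "'m::finite scalar_series"
  shows "(f + g) \<squnion>\<squnion> h = f \<squnion>\<squnion> h + g \<squnion>\<squnion> h"
proof
  show "((f + g) \<squnion>\<squnion> h) w = (f \<squnion>\<squnion> h + g \<squnion>\<squnion> h) w" for w
    by (induction w arbitrary: f g h) (simp_all add: distrib_right)
qed

lemma shuffle_plus_right:
  fixes f g h :: "'m::finite scalar_series"
  shows "f \<squnion>\<squnion> (g + h) = f \<squnion>\<squnion> g + f \<squnion>\<squnion> h"
  by (simp add: shuffle_commute[of f] shuffle_plus_left)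

lemma shuffle_assoc:
  fixes f g h :: "'m::finite scalar_series"
  shows "(f \<squnion>\<squnion> g) \<squnion>\<squnion> h = f \<squnion>\<squnion> (g \<squnion>\<squnion> h)"
proof
  show "((f \<squnion>\<squnion> g) \<squnion>\<squnion> h) w = (f \<squnion>\<squnion> (g \<squnion>\<squnion> h)) w" for w
    by (induction w arbitrary: f g h) (simp_all add: shuffle_plus_left shuffle_plus_right)
qed

lemma shuffle_left_commute:
  fixes f g h :: "'m::finite scalar_series"
  shows "f \<squnion>\<squnion> (g \<squnion>\<squnion> h) = g \<squnion>\<squnion> (f \<squnion>\<squnion> h)"
  by (metis shuffle_assoc shuffle_commute)

text \<open>Left quotients are linear, so induction on the word applies. The real coefficients allow
  truncated expansions of \<open>subst\<close> to be pulled out of a shuffle.\<close>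

lemma shuffle_sum_right:
  fixes f :: "'m::finite scalar_series" and g :: "'a \<Rightarrow> 'm scalar_series"
  shows "(f \<squnion>\<squnion> (\<lambda>v. \<Sum>i\<in>I. a i * g i v)) w = (\<Sum>i\<in>I. a i * (f \<squnion>\<squnion> g i) w)"
proof (induction w arbitrary: f g)
  case Nil
  then show ?case by (simp add: sum_distrib_left mult_ac)
next
  case (Cons x w)
  have "left_quotient x (\<lambda>v. \<Sum>i\<in>I. a i * g i v) = (\<lambda>v. \<Sum>i\<in>I. a i * left_quotient x (g i) v)"
    by (simp add: fun_eq_iff)
  then show ?case
    unfolding shuffle_Cons by (simp only: Cons sum.distrib distrib_left)
qed


section \<open>Ultrametric closeness\<close>

text \<open>This is a ball of the ultrametric: \<open>f - g\<close> has order at least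
  \<open>n\<close>. The codomain is arbitrary so that scalar and vector-valued series are both
  covered.\<close>

definition agree :: "nat \<Rightarrow> ('m word \<Rightarrow> 'b) \<Rightarrow> ('m word \<Rightarrow> 'b) \<Rightarrow> bool" where
  "agree n f g \<longleftrightarrow> (\<forall>w. length w < n \<longrightarrow> f w = g w)"

lemma agreeD: "agree n f g \<Longrightarrow> length w < n \<Longrightarrow> f w = g w"
  by (simp add: agree_def)

lemma agree_refl [simp]: "agree n f f"
  by (simp add: agree_def)

lemma agree_eqI: "(\<And>n. agree n f g) \<Longrightarrow> f = g"
  unfolding agree_def fun_eq_iff by blast

text \<open>A coefficient of the shuffle at \<open>w\<close> involves only coefficients at words no
  longer than \<open>w\<close>.\<close>

lemma agree_shuffle:
  fixes f g :: "'m::finite scalar_series"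
  assumes "agree n f f'" "agree n g g'"
  shows "agree n (f \<squnion>\<squnion> g) (f' \<squnion>\<squnion> g')"
  unfolding agree_def
proof (intro allI impI)
  fix w :: "'m word"
  assume "length w < n"
  with assms show "(f \<squnion>\<squnion> g) w = (f' \<squnion>\<squnion> g') w"
    by (simp add: shuffle_eq_sum[of w "length w" "length w"] agree_def)
qed


section \<open>Substitution of \<open>\<delta> + e\<close> into scalar series\<close>

text \<open>The letter \<open>x\<^sub>0\<close> is assigned \<open>u\<close>: \<open>c\<^sub>0 = 1\<close> for the composition and \<open>e\<^sub>0 = 0\<close> for the modified one.\<close>

definition inlet :: "'m scalar_series \<Rightarrow> ('m, 'k::finite) series \<Rightarrow> 'k option \<Rightarrow> 'm scalar_series" where
  "inlet u e x = (case x of None \<Rightarrow> u | Some i \<Rightarrow> component e i)"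

lemma inlet_simps [simp]: "inlet u e None = u" "inlet u e (Some i) = component e i"
  by (simp_all add: inlet_def)

lemma phi_letter_eq: "phi_letter e x f = prepend x f + prepend None (inlet 0 e x \<squnion>\<squnion> f)"
  by (cases x) simp_all

lemma psi_letter_eq: "psi_letter c x f = prepend None (inlet one_series c x \<squnion>\<squnion> f)"
  by (cases x) simp_all

text \<open>The scalar version of \<open>\<odot>\<^sub>m\<close>: shuffles are defined for scalar
  series only, and \<open>\<odot>\<^sub>m\<close> acts by \<open>subst\<close> on each
  component.\<close>

definition subst :: "('m::finite, 'm) series \<Rightarrow> 'm scalar_series \<Rightarrow> 'm scalar_series" where
  "subst e a w = (\<Sum>\<eta>. a \<eta> * phi e \<eta> one_series w)"

lemma subst_eq_sum:
  assumes "length w \<le> n"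
  shows "subst e a w = (\<Sum>\<eta>\<in>words_upto n. a \<eta> * phi e \<eta> one_series w)"
  unfolding subst_def
  by (rule Sum_any_eq_sum_words_upto) (use assms in \<open>auto dest!: length_phi\<close>)

lemma subst_Nil [simp]: "subst e a [] = a []"
  by (simp add: subst_eq_sum[of _ 0])

text \<open>Substitution turns a letter \<open>x\<close> into \<open>x\<close> plus
  \<open>x_0\<close> followed by a shuffle with the component of \<open>e\<close> at
  \<open>x\<close>. Hence every left quotient sees the first summand of its own letter, and the
  quotient by \<open>x_0\<close> also collects the second summands of all letters.\<close>

lemma subst_Cons [simp]:
  "subst e a (z # w) = subst e (left_quotient z a) w +
    (if z = None then \<Sum>x\<in>UNIV. (inlet 0 e x \<squnion>\<squnion> subst e (left_quotient x a)) w else 0)"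
proof -
  let ?n = "length w"
  let ?p = "\<lambda>\<eta>. phi e \<eta> one_series"
  have shuf: "(\<Sum>\<eta>\<in>words_upto ?n. a (x # \<eta>) * (inlet 0 e x \<squnion>\<squnion> ?p \<eta>) w)
      = (inlet 0 e x \<squnion>\<squnion> subst e (left_quotient x a)) w" for x
  proof -
    \<comment> \<open>One truncation bound serves all words up to the length of \<open>w\<close>,
      which are the only ones the shuffle reads at \<open>w\<close>.\<close>
    have "agree (Suc ?n) (subst e (left_quotient x a)) (\<lambda>v. \<Sum>\<eta>\<in>words_upto ?n. a (x # \<eta>) * ?p \<eta> v)"
      by (simp add: agree_def subst_eq_sum[where n = ?n])
    from agreeD[OF agree_shuffle[OF agree_refl[of _ "inlet 0 e x"] this], of w] show ?thesis
      by (simp add: shuffle_sum_right)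
  qed
  have "subst e a (z # w) = (\<Sum>x\<in>UNIV. \<Sum>\<eta>\<in>words_upto ?n. a (x # \<eta>) * ?p (x # \<eta>) (z # w))"
    by (subst subst_eq_sum[of _ "Suc ?n"]) (simp_all add: sum_words_upto_Suc)
  also have "\<dots> = (\<Sum>x\<in>UNIV. (if x = z then \<Sum>\<eta>\<in>words_upto ?n. a (x # \<eta>) * ?p \<eta> w else 0) +
      (if z = None then \<Sum>\<eta>\<in>words_upto ?n. a (x # \<eta>) * (inlet 0 e x \<squnion>\<squnion> ?p \<eta>) w else 0))"
    by (intro sum.cong refl) (auto simp: phi_letter_eq distrib_left sum.distrib)
  also have "\<dots> = subst e (left_quotient z a) w +
      (if z = None then \<Sum>x\<in>UNIV. (inlet 0 e x \<squnion>\<squnion> subst e (left_quotient x a)) w else 0)"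
    by (cases "z = None") (simp_all add: sum.distrib shuf subst_eq_sum[of w ?n] del: not_None_eq)
  finally show ?thesis .
qed

lemma subst_plus: "subst e (a + b) = subst e a + subst e b"
  by (rule ext) (simp add: subst_eq_sum[OF order_refl] distrib_right sum.distrib)

lemma subst_zero [simp]: "subst e 0 = 0"
  by (rule ext) (simp add: subst_eq_sum[OF order_refl])

lemma subst_one [simp]: "subst e one_series = one_series"
proof
  show "subst e one_series w = one_series w" for w
    by (cases w) simp_all
qed

text \<open>Substitution intertwines \<open>prepend x\<close> with \<open>phi_letter e x\<close>,
  now for an arbitrary series \<open>a\<close> in place of a word.\<close>

lemma subst_prepend:
  "subst e (prepend x a) = prepend x (subst e a) + prepend None (inlet 0 e x \<squnion>\<squnion> subst e a)"
proof
  fix w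
  have "(\<Sum>y\<in>UNIV. (inlet 0 e y \<squnion>\<squnion> subst e (if y = x then a else 0)) v) =
      (\<Sum>y\<in>UNIV. if y = x then (inlet 0 e x \<squnion>\<squnion> subst e a) v else 0)" for v
    by (intro sum.cong) auto
  then show "subst e (prepend x a) w =
      (prepend x (subst e a) + prepend None (inlet 0 e x \<squnion>\<squnion> subst e a)) w"
    by (cases w) auto
qed

lemma subst_zero_left [simp]: "subst 0 a = a"
proof
  have inlet_zero: "inlet 0 0 x = 0" for x :: "'a option"
    by (cases x) (simp_all add: component_def fun_eq_iff)
  show "subst 0 a w = a w" for w
    by (induction w arbitrary: a) (simp_all add: inlet_zero)
qed

text \<open>Each letter of \<open>e\<close> enters behind a letter \<open>x\<^sub>0\<close>, which gains one order.\<close>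

lemma agree_subst:
  assumes "agree n e e'"
  shows "agree (Suc n) (subst e a) (subst e' a)"
proof -
  have "agree k (subst e a) (subst e' a)" if "k \<le> Suc n" for k
    using that
  proof (induction k arbitrary: a)
    case 0
    then show ?case by (simp add: agree_def)
  next
    case (Suc k)
    \<comment> \<open>Here \<open>Suc k \<le> Suc n\<close> gives \<open>k \<le> n\<close>, so the
      assumption on \<open>e\<close> suffices: this is the gained order.\<close>
    have inl: "agree k (inlet 0 e x) (inlet 0 e' x)" for x
      using assms Suc.prems by (cases x) (simp_all add: agree_def component_def)
    show ?case
      unfolding agree_def
    proof (intro allI impI)
      fix w :: "'a word"
      assume w: "length w < Suc k"
      show "subst e a w = subst e' a w"
      proof (cases w)
        case (Cons z v)
        with w have v: "length v < k" by simp
        have IH: "agree k (subst e b) (subst e' b)" for b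
          using Suc by simp
        show ?thesis
          by (simp add: Cons agreeD[OF IH v] agreeD[OF agree_shuffle[OF inl IH] v])
      qed simp
    qed
  qed
  then show ?thesis by simp
qed

text \<open>Left quotients are derivations, and the correction term of \<open>subst_Cons\<close>
  obeys the Leibniz rule along \<open>subst\<close>, so both sides satisfy the same recursion. The
  induction is on the order of agreement because a shuffle with a component of \<open>e\<close>
  reads all words up to the length of the tail, not just the tail.\<close>

lemma subst_shuffle: "subst e (a \<squnion>\<squnion> b) = subst e a \<squnion>\<squnion> subst e b"
proof (rule agree_eqI)
  fix n
  show "agree n (subst e (a \<squnion>\<squnion> b)) (subst e a \<squnion>\<squnion> subst e b)"
  proof (induction n arbitrary: a b)
    case 0
    then show ?case by (simp add: agree_def)
  next
    case (Suc n)
    let ?D = "left_quotient" and ?T = "subst e" and ?i = "inlet 0 e"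
    show ?case
      unfolding agree_def
    proof (intro allI impI)
      fix w :: "'a word"
      assume w: "length w < Suc n"
      show "?T (a \<squnion>\<squnion> b) w = (?T a \<squnion>\<squnion> ?T b) w"
      proof (cases w)
        case (Cons z v)
        with w have v: "length v < n" by simp
        have IH: "?T (f \<squnion>\<squnion> g) v = (?T f \<squnion>\<squnion> ?T g) v" for f g
          using agreeD[OF Suc v] .
        have IHi: "(?i x \<squnion>\<squnion> ?T (f \<squnion>\<squnion> g)) v = (?i x \<squnion>\<squnion> (?T f \<squnion>\<squnion> ?T g)) v" for x f g
          using agreeD[OF agree_shuffle[OF agree_refl Suc] v] .
        \<comment> \<open>The factor \<open>1\<close> only gives the sum the shape required by
          \<open>shuffle_sum_right\<close>.\<close>
        have quot: "?D z (?T f) = ?T (?D z f) +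
            (if z = None then \<lambda>u. \<Sum>x\<in>UNIV. 1 * (?i x \<squnion>\<squnion> ?T (?D x f)) u else 0)" for f
          by (auto simp: fun_eq_iff)
        show ?thesis
        proof (cases "z = None")
          case False
          then show ?thesis
            by (simp add: Cons quot subst_plus IH del: not_None_eq)
        next
          case True
          have R: "(?T a \<squnion>\<squnion> (\<lambda>u. \<Sum>x\<in>UNIV. 1 * (?i x \<squnion>\<squnion> ?T (?D x b)) u)) v
              = (\<Sum>x\<in>UNIV. (?i x \<squnion>\<squnion> (?T a \<squnion>\<squnion> ?T (?D x b))) v)"
            unfolding shuffle_sum_right by (simp add: shuffle_left_commute)
          have L: "((\<lambda>u. \<Sum>x\<in>UNIV. 1 * (?i x \<squnion>\<squnion> ?T (?D x a)) u) \<squnion>\<squnion> ?T b) v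
              = (\<Sum>x\<in>UNIV. (?i x \<squnion>\<squnion> (?T (?D x a) \<squnion>\<squnion> ?T b)) v)"
            unfolding shuffle_commute[of _ "?T b"] shuffle_sum_right
            by (simp only: mult_1 shuffle_left_commute[of "?T b"])
          have "?T (a \<squnion>\<squnion> b) w = (?T (?D z a) \<squnion>\<squnion> ?T b) v + (?T a \<squnion>\<squnion> ?T (?D z b)) v
              + ((\<Sum>x\<in>UNIV. (?i x \<squnion>\<squnion> (?T (?D x a) \<squnion>\<squnion> ?T b)) v)
                + (\<Sum>x\<in>UNIV. (?i x \<squnion>\<squnion> (?T a \<squnion>\<squnion> ?T (?D x b))) v))"
            using True by (simp add: Cons subst_plus shuffle_plus_right IH IHi sum.distrib)
          also have "\<dots> = (?D z (?T a) \<squnion>\<squnion> ?T b) v + (?T a \<squnion>\<squnion> ?D z (?T b)) v"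
            unfolding quot if_P[OF True] shuffle_plus_left shuffle_plus_right plus_fun_apply L R
            by simp
          also have "\<dots> = (?T a \<squnion>\<squnion> ?T b) w"
            by (simp add: Cons)
          finally show ?thesis .
        qed
      qed simp
    qed
  qed
qed


section \<open>Associativity\<close>

lemma component_mod_composition: "component (c \<odot>\<^sub>m e) i = subst e (component c i)"
proof
  fix w
  have "(c \<odot>\<^sub>m e) w = (\<Sum>\<eta>\<in>words_upto (length w). phi e \<eta> one_series w *\<^sub>R c \<eta>)"
    unfolding mod_composition_def
    by (rule Sum_any_eq_sum_words_upto) (auto dest!: length_phi)
  then show "component (c \<odot>\<^sub>m e) i w = subst e (component c i) w"
    by (simp add: component_def subst_eq_sum[OF order_refl] mult.commute)
qed

lemma component_composition:
  fixes c :: "('m::finite, 'k::finite) series"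
  assumes "length w \<le> n"
  shows "component (d \<odot> c) i w = (\<Sum>\<eta>\<in>words_upto n. component d i \<eta> * psi c \<eta> one_series w)"
proof -
  have "(d \<odot> c) w = (\<Sum>\<eta>\<in>words_upto n. psi c \<eta> one_series w *\<^sub>R d \<eta>)"
    unfolding composition_def
    by (rule Sum_any_eq_sum_words_upto) (use assms in \<open>auto dest!: length_psi\<close>)
  then show ?thesis
    by (simp add: component_def mult.commute)
qed

lemma series_eqI:
  fixes c c' :: "('m, 'l::finite) series"
  assumes "\<And>i. component c i = component c' i"
  shows "c = c'"
proof
  show "c w = c' w" for w
    using assms by (simp add: vec_eq_iff component_def fun_eq_iff)
qed

lemma component_plus: "component (c + c') i = component c i + component c' i"
  by (simp add: component_def fun_eq_iff)

lemma component_zero [simp]: "component 0 i = 0"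
  by (simp add: component_def fun_eq_iff)

text \<open>Linearity and continuity of substitution: its value at \<open>w\<close> depends on
  \<open>a\<close> only up to the length of \<open>w\<close>, so an expansion valid there is
  enough.\<close>

lemma subst_sum_words_upto:
  fixes g :: "'k::finite word \<Rightarrow> 'm::finite scalar_series"
  assumes "\<And>v. length v \<le> length w \<Longrightarrow> a v = (\<Sum>\<eta>\<in>words_upto (length w). b \<eta> * g \<eta> v)"
  shows "subst f a w = (\<Sum>\<eta>\<in>words_upto (length w). b \<eta> * subst f (g \<eta>) w)"
proof -
  have "subst f a w = (\<Sum>\<xi>\<in>words_upto (length w). \<Sum>\<eta>\<in>words_upto (length w).
      b \<eta> * g \<eta> \<xi> * phi f \<xi> one_series w)"
    by (simp add: subst_eq_sum[OF order_refl] assms sum_distrib_right)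
  also have "\<dots> = (\<Sum>\<eta>\<in>words_upto (length w). b \<eta> * subst f (g \<eta>) w)"
    by (subst sum.swap) (simp add: subst_eq_sum[OF order_refl] sum_distrib_left mult.assoc)
  finally show ?thesis .
qed

text \<open>Substituting \<open>\<delta> + f\<close> sends a letter \<open>x\<close> to
  \<open>x\<close> plus an \<open>x_0\<close>-term from \<open>f\<close>, and fixes
  \<open>x_0\<close> since \<open>f\<close> has zero component there. With
  \<open>subst_shuffle\<close>, the term from \<open>e\<close> becomes one from
  \<open>e \<odot>\<^sub>m f\<close>, and the two \<open>x_0\<close>-terms add up.\<close>

lemma subst_phi: "subst f (phi e \<eta> one_series) = phi (f + e \<odot>\<^sub>m f) \<eta> one_series"
proof (induction \<eta>)
  case (Cons x \<eta>)
  have "inlet 0 (f + e \<odot>\<^sub>m f) x = inlet 0 f x + subst f (inlet 0 e x)"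
    by (cases x) (simp_all add: component_plus component_mod_composition)
  then show ?case
    by (simp add: Cons phi_letter_eq subst_plus subst_prepend subst_shuffle shuffle_plus_left prepend_plus add_ac
        del: plus_fun_apply)
qed simp

text \<open>Every letter acts through \<open>x_0\<close>, which substitution fixes, so only the
  shuffle factors change; the factor \<open>one_series\<close> of the letter \<open>None\<close> is
  preserved.\<close>

lemma subst_psi: "subst f (psi c \<eta> one_series) = psi (c \<odot>\<^sub>m f) \<eta> one_series"
proof (induction \<eta>)
  case (Cons x \<eta>)
  have "inlet one_series (c \<odot>\<^sub>m f) x = subst f (inlet one_series c x)"
    by (cases x) (simp_all add: component_mod_composition)
  then show ?case
    by (simp add: Cons psi_letter_eq subst_prepend subst_shuffle del: plus_fun_apply)
qed simp

text \<open>By \<open>subst_phi\<close> it suffices to expand \<open>c\<close> over words. The right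
  argument is the series part of the product of \<open>\<delta> + e\<close> and
  \<open>\<delta> + f\<close>.\<close>

lemma mod_composition_assoc: "c \<odot>\<^sub>m e \<odot>\<^sub>m f = c \<odot>\<^sub>m (f + e \<odot>\<^sub>m f)"
proof (rule series_eqI, rule ext)
  fix i w
  have "subst f (subst e (component c i)) w =
      (\<Sum>\<eta>\<in>words_upto (length w). component c i \<eta> * subst f (phi e \<eta> one_series) w)"
    by (rule subst_sum_words_upto) (simp add: subst_eq_sum)
  then show "component (c \<odot>\<^sub>m e \<odot>\<^sub>m f) i w = component (c \<odot>\<^sub>m (f + e \<odot>\<^sub>m f)) i w"
    by (simp add: component_mod_composition subst_phi subst_eq_sum[OF order_refl])
qed

lemma composition_mod_composition_assoc:
  fixes c :: "('m::finite, 'k::finite) series"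
  shows "d \<odot> c \<odot>\<^sub>m f = d \<odot> (c \<odot>\<^sub>m f)"
proof (rule series_eqI, rule ext)
  fix i w
  have "subst f (component (d \<odot> c) i) w =
      (\<Sum>\<eta>\<in>words_upto (length w). component d i \<eta> * subst f (psi c \<eta> one_series) w)"
    by (rule subst_sum_words_upto) (simp add: component_composition)
  then show "component (d \<odot> c \<odot>\<^sub>m f) i w = component (d \<odot> (c \<odot>\<^sub>m f)) i w"
    by (simp add: component_mod_composition subst_psi component_composition[OF order_refl])
qed

lemma mod_composition_zero_left [simp]: "0 \<odot>\<^sub>m e = 0"
  by (rule series_eqI) (simp add: component_mod_composition)

lemma mod_composition_zero_right [simp]: "c \<odot>\<^sub>m 0 = c"
  by (rule series_eqI) (simp add: component_mod_composition)

lemma mod_composition_plus_left: "(c + c') \<odot>\<^sub>m e = c \<odot>\<^sub>m e + c' \<odot>\<^sub>m e"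
  by (rule series_eqI) (simp add: component_mod_composition component_plus subst_plus)

lemma mod_composition_uminus_left: "(- c) \<odot>\<^sub>m e = - (c \<odot>\<^sub>m e)"
  using mod_composition_plus_left[of "- c" c e] by (simp add: eq_neg_iff_add_eq_0)


section \<open>The group of formal elements\<close>

lemma agree_mod_composition:
  assumes "agree n e e'"
  shows "agree (Suc n) (c \<odot>\<^sub>m e) (c \<odot>\<^sub>m e')"
  unfolding agree_def
proof (intro allI impI)
  fix w :: "'a word"
  assume w: "length w < Suc n"
  have "component (c \<odot>\<^sub>m e) i w = component (c \<odot>\<^sub>m e') i w" for i
    unfolding component_mod_composition by (rule agreeD[OF agree_subst[OF assms] w])
  then show "(c \<odot>\<^sub>m e) w = (c \<odot>\<^sub>m e') w"
    by (simp add: vec_eq_iff component_def)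
qed

text \<open>Banach iteration by hand: each application of the contraction fixes the coefficients of
  one more word length.\<close>

lemma mod_composition_fixed_point:
  fixes a :: "('m::finite, 'm) series"
  obtains x where "x = a \<odot>\<^sub>m x"
proof -
  define X where "X n = ((\<odot>\<^sub>m) a ^^ n) 0" for n
  have X_Suc: "X (Suc n) = a \<odot>\<^sub>m X n" for n
    by (simp add: X_def)
  have step: "agree n (X n) (X (n + k))" for n k
  proof (induction n)
    case 0
    then show ?case by (simp add: agree_def)
  next
    case (Suc n)
    then show ?case by (simp add: X_Suc agree_mod_composition)
  qed
  \<comment> \<open>The iterate \<open>X n\<close> is final on words shorter than \<open>n\<close>,
    hence the successor of the length.\<close>
  define x where "x w = X (Suc (length w)) w" for w
  have lim: "agree n x (X n)" for n
    unfolding agree_def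
  proof (intro allI impI)
    fix w :: "'m word"
    assume "length w < n"
    then obtain k where "n = Suc (length w) + k"
      by (metis Suc_leI le_Suc_ex)
    then show "x w = X n w"
      using agreeD[OF step[of "Suc (length w)" k], of w] by (simp add: x_def)
  qed
  have "x = a \<odot>\<^sub>m x"
  proof (rule agree_eqI)
    fix n
    have "agree (Suc n) x (X (Suc n))" "agree (Suc n) (a \<odot>\<^sub>m x) (X (Suc n))"
      using lim[of "Suc n"] agree_mod_composition[OF lim[of n]] by (simp_all add: X_Suc)
    then show "agree n x (a \<odot>\<^sub>m x)"
      by (simp add: agree_def)
  qed
  then show ?thesis by (rule that)
qed

lemma delta_group_simps [simp]:
  "carrier delta_group = UNIV"
  "a \<otimes>\<^bsub>delta_group\<^esub> b = Delta (delta_part b + delta_part a \<odot>\<^sub>m delta_part b)"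
  "\<one>\<^bsub>delta_group\<^esub> = Delta 0"
  by (simp_all add: delta_group_def)

lemma monoid_delta_group: "monoid (delta_group :: 'm::finite delta_series monoid)"
  by (rule monoidI)
     (simp_all add: mod_composition_plus_left mod_composition_assoc add.assoc)

text \<open>The condition on \<open>y\<close> is \<open>y + e \<odot>\<^sub>m y = 0\<close>, a
  fixed-point equation for \<open>- e\<close> by linearity in the left argument.\<close>

lemma delta_group_right_inverse:
  obtains y where "Delta e \<otimes>\<^bsub>delta_group\<^esub> Delta y = \<one>\<^bsub>delta_group\<^esub>"
proof -
  obtain y where "y = (- e) \<odot>\<^sub>m y"
    by (rule mod_composition_fixed_point)
  then have "y + e \<odot>\<^sub>m y = 0"
    by (simp add: mod_composition_uminus_left eq_neg_iff_add_eq_0)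
  then show ?thesis by (intro that) simp
qed

lemma group_delta_group: "group (delta_group :: 'm::finite delta_series monoid)"
proof -
  interpret monoid "delta_group :: 'm delta_series monoid"
    by (rule monoid_delta_group)
  have right: "\<exists>b. a \<otimes>\<^bsub>delta_group\<^esub> b = \<one>\<^bsub>delta_group\<^esub>" for a :: "'m delta_series"
    by (cases a) (metis delta_group_right_inverse)
  show ?thesis
  proof (rule group.intro[OF monoid_delta_group], unfold_locales, rule subsetI)
    fix a :: "'m delta_series"
    obtain b where b: "a \<otimes>\<^bsub>delta_group\<^esub> b = \<one>\<^bsub>delta_group\<^esub>" using right by blast
    obtain a' where a': "b \<otimes>\<^bsub>delta_group\<^esub> a' = \<one>\<^bsub>delta_group\<^esub>" using right by blast
    \<comment> \<open>The element \<open>b\<close> has left inverse \<open>a\<close> and right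
      inverse \<open>a'\<close>, so they coincide and \<open>b\<close> is a two-sided inverse of
      \<open>a\<close>.\<close>
    have "a = a'"
      using inv_unique[OF b a'] by (simp del: delta_group_simps(2,3))
    with a' b show "a \<in> Units delta_group"
      unfolding Units_def by auto
  qed
qed

lemma Delta_series_inverse: "Delta (series_inverse e) = inv\<^bsub>delta_group\<^esub> (Delta e)"
  by (simp add: series_inverse_def)

text \<open>In a group a right inverse is the inverse, so the inverse is characterised by a single
  equation; the direction from right to left supplies uniqueness of its solution.\<close>

lemma series_inverse_uminus_eq_iff: "series_inverse (- a) = x \<longleftrightarrow> x = a \<odot>\<^sub>m x"
proof -
  interpret group "delta_group :: 'a delta_series monoid"
    by (rule group_delta_group)
  have "series_inverse (- a) = x \<longleftrightarrow> inv\<^bsub>delta_group\<^esub> (Delta (- a)) = Delta x"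
    by (simp flip: Delta_series_inverse)
  also have "\<dots> \<longleftrightarrow> Delta (- a) \<otimes>\<^bsub>delta_group\<^esub> Delta x = \<one>\<^bsub>delta_group\<^esub>"
    by (metis UNIV_I delta_group_simps(1) inv_equality inv_comm r_inv)
  also have "\<dots> \<longleftrightarrow> x = a \<odot>\<^sub>m x"
    by (simp add: mod_composition_uminus_left)
  finally show ?thesis .
qed

section \<open>The closed-loop fixed point\<close>

theorem theorem8:
  fixes c :: "('mc::finite, 'md::finite) series"
    and d :: "('md, 'mc) series"
  shows "feedback c d = c \<odot>\<^sub>m series_inverse (- (d \<odot> c)) \<and>
    c \<odot>\<^sub>m series_inverse (- (d \<odot> c)) = c \<odot>\<^sub>\<delta> inv\<^bsub>delta_group\<^esub> (Delta (- (d \<odot> c)))"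
proof
  define x where "x = series_inverse (- (d \<odot> c))"
  \<comment> \<open>Mixed associativity rewrites the equation of the inverse so that
    \<open>c \<odot>\<^sub>m x\<close> becomes a fixed point.\<close>
  have x: "d \<odot> (c \<odot>\<^sub>m x) = x"
    using series_inverse_uminus_eq_iff[of "d \<odot> c" x]
    by (simp add: x_def composition_mod_composition_assoc)
  have "e = c \<odot>\<^sub>m x" if e: "e = c \<odot>\<^sub>m (d \<odot> e)" for e
  proof -
    \<comment> \<open>Composing the fixed-point equation with \<open>d\<close> shows that
      \<open>d \<odot> e\<close> solves the equation characterising the inverse.\<close>
    have "d \<odot> e = d \<odot> c \<odot>\<^sub>m (d \<odot> e)"
      by (simp add: composition_mod_composition_assoc flip: e)
    then have "x = d \<odot> e"
      unfolding x_def series_inverse_uminus_eq_iff .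
    with e show ?thesis by simp
  qed
  then show "feedback c d = c \<odot>\<^sub>m series_inverse (- (d \<odot> c))"
    unfolding feedback_def x_def[symmetric] by (intro the_equality) (simp_all add: x)
  show "c \<odot>\<^sub>m series_inverse (- (d \<odot> c)) = c \<odot>\<^sub>\<delta> inv\<^bsub>delta_group\<^esub> (Delta (- (d \<odot> c)))"
    by (simp flip: Delta_series_inverse)
qed

end
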